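(* Let $A$ be a primitive $N\times N$ matrix with Perron--Frobenius eigenvalue $\lambda$, let $(Z_n)_{n\ge 0}$ be a multitype Galton--Watson process with types $\{1,\dots,N\}$ whose mean matrix is $A$, and for each type $i$ let $(Z^i_n)_{n\ge 0}$ be the process stopped on type $i$ (as defined in the context), started from a single individual of type $i$. Then the normalized (left) Perron--Frobenius eigenvector $u$ of $A$ is given by the formula $$\forall i\in\{1,\dots,N\}\qquad u(i)\,=\,\frac{1}{\displaystyle\sum_{n\ge 1}\lambda^{-n}\,E_i\big(|Z^i_n|_1\big)}\,.$$
   Context: Primitive matrix: a square matrix $A$ with non-negative entries such that $A^m$ has all entries positive for some natural number $m$. By the Perron--Frobenius theorem there exist a positive real number $\lambda$ (the Perron--Frobenius eigenvalue) and a vector $u$ with positive coordinates such that $u^TA=\lambda u^T$; $\lambda$ is simple, larger in absolute value than any other eigenvalue of $A$, and any non-negative left eigenvector of $A$ is a multiple of $u$. Such a $u$ is called a Perron--Frobenius eigenvector of $A$ (eigenvectors are left eigenvectors throughout). For a vector $u\in\mathbb R^N$, $|u|_1=|u(1)|+\cdots+|u(N)|$; the normalized Perron--Frobenius eigenvector is the one with $|u|_1=1$. Multitype Galton--Watson process: a Markov chain $Z_n=(Z_n(1),\dots,Z_n(N))$, $n\ge 0$, with state space $\mathbb N^N$ ($0\in\mathbb N$), where $Z_n(i)$ is the number of individuals of type $i$ in generation $n$. To build generation $n+1$ from generation $n$, each individual of type $i$ in generation $n$ produces a random number of offspring (of the various types), distributed according to a prescribed reproduction law depending on $i$, independently of the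 other individuals and of the past of the process; the ensemble of all the offspring forms generation $n+1$. The null vector is absorbing. $E_i$ denotes expectation for the process started from a single individual of type $i$. The mean matrix of the process being $A$ means $E_i(Z_1(j))=A(i,j)$ for all $i,j\in\{1,\dots,N\}$. Stopped process: for a fixed type $i$, $(Z^i_n)_{n\ge 0}$ is the process in which individuals reproduce as in $(Z_n)_{n\ge0}$, except that individuals of type $i$ belonging to generation $1$ or any later generation have no offspring. $E_i$ also denotes expectation for $(Z^i_n)_{n\ge0}$ started from one individual of type $i$ in generation $0$; this initial individual does reproduce as in $(Z_n)_{n\ge 0}$, so that $E_i(Z^i_1(j))=A(i,j)$. Sums of non-negative terms are taken in $[0,\infty]$. *)

theory Defs
  imports "HOL-Probability.Probability"
begin

text \<open>
  The library's \<open>^\<close> on \<open>real ^ 'n ^ 'n\<close> is not the matrix power, since \<open>*\<close> on vectors is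
  componentwise.
\<close>

primrec matrix_power :: "real ^ 'n ^ 'n \<Rightarrow> nat \<Rightarrow> real ^ 'n ^ 'n" where
  "matrix_power A 0 = mat 1"
| "matrix_power A (Suc m) = matrix_power A m ** A"

text \<open>
  The exponent is at least 1: allowing the exponent 0 would make the \<open>1 \<times> 1\<close> zero matrix primitive.
\<close>

definition primitive :: "real ^ 'n ^ 'n \<Rightarrow> bool" where
  "primitive A \<longleftrightarrow>
     (\<forall>i j. 0 \<le> A $ i $ j) \<and> (\<exists>m\<ge>1. \<forall>i j. 0 < matrix_power A m $ i $ j)"

definition pf_eigenvalue :: "real ^ 'n ^ 'n \<Rightarrow> real \<Rightarrow> bool" where
  "pf_eigenvalue A l \<longleftrightarrow> 0 < l \<and> (\<exists>u. (\<forall>i. 0 < u $ i) \<and> u v* A = l *s u)"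

definition pf_eigenvector :: "real ^ 'n ^ 'n \<Rightarrow> real ^ 'n \<Rightarrow> bool" where
  "pf_eigenvector A u \<longleftrightarrow>
     (\<forall>i. 0 < u $ i) \<and> (\<exists>l. pf_eigenvalue A l \<and> u v* A = l *s u)"

definition normalized_pf_eigenvector :: "real ^ 'n ^ 'n \<Rightarrow> real ^ 'n \<Rightarrow> bool" where
  "normalized_pf_eigenvector A u \<longleftrightarrow> pf_eigenvector A u \<and> (\<Sum>i\<in>UNIV. \<bar>u $ i\<bar>) = 1"

text \<open>
  A population is a vector \<open>z :: nat ^ 'n\<close>, where \<open>z $ k\<close> is the number of individuals of type \<open>k\<close>.
  The individuals of \<open>z\<close> are the pairs \<open>(k, l)\<close> with \<open>l < z $ k\<close>. Given the law \<open>p k\<close> of the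
  offspring of an individual of type \<open>k\<close>, \<open>offspring_law p z\<close> is the law of the total offspring of
  \<open>z\<close>, all individuals reproducing independently.
\<close>

definition individuals :: "nat ^ 'n \<Rightarrow> ('n \<times> nat) set" where
  "individuals z = {(k, l). l < z $ k}"

definition offspring_law :: "('n \<Rightarrow> (nat ^ 'n) pmf) \<Rightarrow> nat ^ 'n \<Rightarrow> (nat ^ 'n) pmf" where
  "offspring_law p z =
     map_pmf (\<lambda>X. \<Sum>x\<in>individuals z. X x) (Pi_pmf (individuals z) 0 (\<lambda>x. p (fst x)))"

text \<open>
  A Markov chain on a countable state space, started at \<open>s\<close>; \<open>K n\<close> is the transition kernel from
  time \<open>n\<close> to time \<open>n + 1\<close>. The Markov property is stated in product form, so that no conditioning
  on null events occurs.
\<close>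

definition markov_chain ::
  "'w measure \<Rightarrow> (nat \<Rightarrow> 's \<Rightarrow> 's pmf) \<Rightarrow> 's \<Rightarrow> (nat \<Rightarrow> 'w \<Rightarrow> 's :: countable) \<Rightarrow> bool" where
  "markov_chain M K s Z \<longleftrightarrow>
     prob_space M \<and>
     (\<forall>n. Z n \<in> measurable M (count_space UNIV)) \<and>
     (AE w in M. Z 0 w = s) \<and>
     (\<forall>n z. \<P>(w in M. \<forall>m\<le>Suc n. Z m w = z m) =
            \<P>(w in M. \<forall>m\<le>n. Z m w = z m) * pmf (K n (z n)) (z (Suc n)))"

text \<open>\<open>axis i 1\<close> is the population consisting of a single individual of type \<open>i\<close>.\<close>

definition galton_watson ::
  "('n \<Rightarrow> (nat ^ 'n) pmf) \<Rightarrow> 'n \<Rightarrow> 'w measure \<Rightarrow> (nat \<Rightarrow> 'w \<Rightarrow> nat ^ 'n) \<Rightarrow> bool" where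
  "galton_watson p i M Z \<longleftrightarrow> markov_chain M (\<lambda>n. offspring_law p) (axis i 1) Z"

text \<open>
  \<open>stopped_law p i n k\<close> is the law of the offspring of an individual of type \<open>k\<close> in generation \<open>n\<close>
  of the process stopped on type \<open>i\<close>.
\<close>

definition stopped_law :: "('n \<Rightarrow> (nat ^ 'n) pmf) \<Rightarrow> 'n \<Rightarrow> nat \<Rightarrow> 'n \<Rightarrow> (nat ^ 'n) pmf" where
  "stopped_law p i n k = (if k = i \<and> 1 \<le> n then return_pmf 0 else p k)"

definition stopped_galton_watson ::
  "('n \<Rightarrow> (nat ^ 'n) pmf) \<Rightarrow> 'n \<Rightarrow> 'w measure \<Rightarrow> (nat \<Rightarrow> 'w \<Rightarrow> nat ^ 'n) \<Rightarrow> bool" where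
  "stopped_galton_watson p i M Z \<longleftrightarrow>
     markov_chain M (\<lambda>n. offspring_law (stopped_law p i n)) (axis i 1) Z"

definition population_size :: "nat ^ 'n \<Rightarrow> nat" where
  "population_size z = (\<Sum>j\<in>UNIV. z $ j)"

end

theory Submission
  imports Defs
begin

text \<open>
  Let \<open>g n k\<close> be the mean number of individuals of type \<open>k\<close> in generation \<open>n\<close> of the process
  stopped on \<open>i\<close>. Then \<open>g 1\<close> is row \<open>i\<close> of \<open>A\<close>, and each later \<open>g (n + 1)\<close> is \<open>g n\<close> multiplied by
  \<open>A\<close> with row \<open>i\<close> set to zero. Induction on the partial sums of \<open>w k = (\<Sum>n\<ge>1. g n k / l ^ n)\<close>
  gives \<open>w \<le> u / u i\<close>. The defect \<open>d = u / u i - w \<ge> 0\<close> satisfies \<open>d A = l d + d i A i \<ge> l d\<close>,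
  where \<open>A i\<close> is row \<open>i\<close>; by primitivity \<open>d\<close> is then a multiple of \<open>u\<close>, so that \<open>d i A i = 0\<close>,
  hence \<open>d i = 0\<close> and \<open>d = 0\<close>. Summing \<open>w k = u k / u i\<close> over \<open>k\<close> gives the formula.
\<close>

section \<open>Non-negative matrices and comparison with a positive eigenvector\<close>

lemma vector_matrix_mult_nth: "(x v* A) $ k = (\<Sum>j\<in>UNIV. x $ j * A $ j $ k)"
  for A :: "real ^ 'n ^ 'm"
  by (simp add: vector_matrix_mult_def mult.commute)

lemma vector_matrix_mult_mono:
  fixes A :: "real ^ 'n ^ 'm"
  assumes "\<And>i j. 0 \<le> A $ i $ j" and "\<And>k. x $ k \<le> y $ k"
  shows "(x v* A) $ k \<le> (y v* A) $ k"
  unfolding vector_matrix_mult_nth by (intro sum_mono mult_right_mono assms)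

lemma vector_matrix_mult_power_Suc: "x v* matrix_power A (Suc m) = (x v* matrix_power A m) v* A"
  by (simp add: vector_matrix_mul_assoc)

text \<open>Row \<open>i\<close> of a product is row \<open>i\<close> of the left factor times the
  right factor, so a zero row persists. The power 0 is excluded because it is the identity.\<close>

lemma matrix_power_zero_row:
  assumes "\<And>k. A $ i $ k = 0" and "m \<ge> 1"
  shows "matrix_power A m $ i $ k = 0"
  using assms(2)
proof (induction m arbitrary: k rule: dec_induct)
  case base
  then show ?case by (simp add: assms)
next
  case (step m)
  then show ?case by (simp add: matrix_matrix_mult_def)
qed

lemma eigenvector_matrix_power:
  assumes "u v* A = l *s u"
  shows "u v* matrix_power A m = l ^ m *s u"
proof (induction m)
  case (Suc m)
  then show ?case
    by (simp only: vector_matrix_mult_power_Suc scalar_vector_matrix_assoc assms)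
      (simp add: vec_eq_iff)
qed simp

text \<open>Non-negativity of \<open>A\<close> makes multiplication by \<open>A\<close> monotone, so
  the inequality for \<open>d\<close> can be iterated.\<close>

lemma subinvariant_matrix_power:
  fixes A :: "real ^ 'n ^ 'n"
  assumes A: "\<And>i j. 0 \<le> A $ i $ j" and l: "0 \<le> l" and d: "\<And>k. l * d $ k \<le> (d v* A) $ k"
  shows "l ^ m * d $ k \<le> (d v* matrix_power A m) $ k"
proof (induction m arbitrary: k)
  case (Suc m)
  have "l ^ Suc m * d $ k = l ^ m * (l * d $ k)" by (simp add: mult_ac)
  also have "\<dots> \<le> l ^ m * (d v* A) $ k" using l by (intro mult_left_mono d) auto
  also have "\<dots> = ((l ^ m *s d) v* A) $ k" by (simp add: scalar_vector_matrix_assoc)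
  also have "\<dots> \<le> ((d v* matrix_power A m) v* A) $ k"
    by (rule vector_matrix_mult_mono[OF A]) (simp add: Suc.IH)
  finally show ?case by (simp only: vector_matrix_mult_power_Suc)
qed simp

text \<open>There are finitely many ratios \<open>d $ j / u $ j\<close>; scaled by the largest one,
  \<open>u\<close> dominates \<open>d\<close> and touches it at \<open>k\<close>. This comparison
  gives both the uniqueness of the eigenvalue and the proportionality of subinvariant
  vectors.\<close>

lemma ratio_maximum:
  fixes d u :: "real ^ 'n"
  assumes "\<And>k. 0 < u $ k"
  obtains k where "\<And>j. d $ j \<le> d $ k / u $ k * u $ j"
proof -
  have "Max (range (\<lambda>j. d $ j / u $ j)) \<in> range (\<lambda>j. d $ j / u $ j)"
    by (rule Max_in) auto
  then obtain k where "Max (range (\<lambda>j. d $ j / u $ j)) = d $ k / u $ k" by (rule rangeE)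
  hence k: "d $ j / u $ j \<le> d $ k / u $ k" for j
    using Max_ge[of "range (\<lambda>j. d $ j / u $ j)" "d $ j / u $ j"] by simp
  show thesis
    by (rule that[of k]) (use k assms in \<open>simp add: pos_divide_le_eq\<close>)
qed

text \<open>Scale \<open>u\<close> so that it dominates \<open>v\<close> and equals it at one index
  \<open>k\<close>. Multiplication by \<open>A\<close> keeps the order, and coordinate
  \<open>k\<close> then compares the eigenvalues.\<close>

lemma positive_eigenvalue_le:
  fixes A :: "real ^ 'n ^ 'n"
  assumes A: "\<And>i j. 0 \<le> A $ i $ j"
    and u: "\<And>k. 0 < u $ k" "u v* A = l *s u"
    and v: "\<And>k. 0 < v $ k" "v v* A = l' *s v"
  shows "l' \<le> l"
proof -
  obtain k where k: "\<And>j. v $ j \<le> v $ k / u $ k * u $ j"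
    using ratio_maximum[OF u(1)] by blast
  have "l' * v $ k = (v v* A) $ k" by (simp add: v)
  also have "\<dots> \<le> ((v $ k / u $ k) *s u v* A) $ k"
    by (rule vector_matrix_mult_mono[OF A]) (simp add: k[simplified])
  also have "\<dots> = l * v $ k"
    using u(1)[of k] by (simp add: scalar_vector_matrix_assoc u(2))
  finally show ?thesis using v(1)[of k] by simp
qed

text \<open>
  At an index where \<open>d / u\<close> is maximal, with value \<open>c\<close>, the bounds \<open>l ^ m d \<le> d A ^ m \<le> c u A ^ m\<close>
  are equalities; since \<open>A ^ m\<close> is positive, this forces \<open>d = c u\<close>.
\<close>

lemma subinvariant_proportional:
  fixes A :: "real ^ 'n ^ 'n"
  assumes A: "primitive A" and l: "0 < l"
    and u: "\<And>k. 0 < u $ k" "u v* A = l *s u"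
    and d: "\<And>k. l * d $ k \<le> (d v* A) $ k"
  obtains c where "d = c *s u"
proof -
  from A obtain m where nonneg: "\<And>i j. 0 \<le> A $ i $ j"
    and m: "\<And>i j. 0 < matrix_power A m $ i $ j"
    unfolding primitive_def by blast
  obtain k where k: "\<And>j. d $ j \<le> d $ k / u $ k * u $ j"
    using ratio_maximum[OF u(1)] by blast
  define c where "c = d $ k / u $ k"
  have "(\<Sum>j\<in>UNIV. (c * u $ j - d $ j) * matrix_power A m $ j $ k)
      = c * (u v* matrix_power A m) $ k - (d v* matrix_power A m) $ k"
    by (simp add: vector_matrix_mult_nth sum_distrib_left sum_subtractf algebra_simps)
  also have "\<dots> \<le> c * (l ^ m * u $ k) - l ^ m * d $ k"
    using subinvariant_matrix_power[OF nonneg less_imp_le[OF l] d, of m k]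
    by (simp add: eigenvector_matrix_power[OF u(2)])
  also have "\<dots> = 0" using u(1)[of k] by (simp add: c_def)
  finally have le: "(\<Sum>j\<in>UNIV. (c * u $ j - d $ j) * matrix_power A m $ j $ k) \<le> 0" .
  have ge: "0 \<le> (c * u $ j - d $ j) * matrix_power A m $ j $ k" for j
    using k[of j] m[of j k] by (simp add: c_def)
  have "(\<Sum>j\<in>UNIV. (c * u $ j - d $ j) * matrix_power A m $ j $ k) = 0"
    using le sum_nonneg[of UNIV "\<lambda>j. (c * u $ j - d $ j) * matrix_power A m $ j $ k"] ge by force
  hence "(c * u $ j - d $ j) * matrix_power A m $ j $ k = 0" for j
    using ge by (simp add: sum_nonneg_eq_0_iff)
  hence "d $ j = c * u $ j" for j using m[of j k] by (metis eq_iff_diff_eq_0 less_irrefl mult_eq_0_iff)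
  thus thesis by (intro that[of c]) (simp add: vec_eq_iff)
qed

section \<open>Discounted means of the stopped process\<close>

text \<open>The index is shifted: \<open>stopped_mean A i n\<close> belongs to generation \<open>n + 1\<close>.\<close>

primrec stopped_mean :: "real ^ 'n ^ 'n \<Rightarrow> 'n \<Rightarrow> nat \<Rightarrow> 'n \<Rightarrow> real" where
  "stopped_mean A i 0 k = A $ i $ k"
| "stopped_mean A i (Suc n) k = (\<Sum>j\<in>-{i}. stopped_mean A i n j * A $ j $ k)"

lemma stopped_mean_nonneg:
  assumes "\<And>i j. 0 \<le> A $ i $ j"
  shows "0 \<le> stopped_mean A i n k"
  by (induction n arbitrary: k) (auto intro!: sum_nonneg mult_nonneg_nonneg assms)

lemma stopped_mean_sums:
  fixes A :: "real ^ 'n ^ 'n"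
  assumes A: "primitive A" and l: "0 < l"
    and u: "\<And>k. 0 < u $ k" "u v* A = l *s u"
  shows "(\<lambda>n. stopped_mean A i n k / l ^ Suc n) sums (u $ k / u $ i)"
proof -
  have nonneg: "\<And>i j. 0 \<le> A $ i $ j" using A by (auto simp: primitive_def)
  note tn = stopped_mean_nonneg[of A i, OF nonneg]
  define W where "W N k = (\<Sum>n<N. stopped_mean A i n k / l ^ Suc n)" for N k
  \<comment> \<open>Splitting off the first term and shifting the index shows that
    \<open>W (Suc N)\<close> arises from \<open>W N\<close> by an affine map with non-negative
    coefficients.\<close>
  have W_Suc: "W (Suc N) k = A $ i $ k / l + (\<Sum>j\<in>-{i}. W N j * A $ j $ k) / l" for N k
  proof -
    have "W (Suc N) k = A $ i $ k / l + (\<Sum>n<N. (\<Sum>j\<in>-{i}. stopped_mean A i n j * A $ j $ k) / l ^ Suc (Suc n))"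
      unfolding W_def by (subst sum.lessThan_Suc_shift) simp
    also have "(\<Sum>n<N. (\<Sum>j\<in>-{i}. stopped_mean A i n j * A $ j $ k) / l ^ Suc (Suc n))
      = (\<Sum>n<N. \<Sum>j\<in>-{i}. stopped_mean A i n j / l ^ Suc n * A $ j $ k / l)"
      by (simp add: sum_divide_distrib mult_ac)
    also have "\<dots> = (\<Sum>j\<in>-{i}. \<Sum>n<N. stopped_mean A i n j / l ^ Suc n * A $ j $ k / l)"
      by (rule sum.swap)
    also have "\<dots> = (\<Sum>j\<in>-{i}. W N j * A $ j $ k) / l"
      by (simp only: W_def sum_divide_distrib sum_distrib_right)
    finally show ?thesis .
  qed
  have split: "(x v* A) $ k = x $ i * A $ i $ k + (\<Sum>j\<in>-{i}. x $ j * A $ j $ k)" for x k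
    unfolding vector_matrix_mult_nth by (subst sum.remove[of _ i]) (auto simp: Compl_eq_Diff_UNIV)
  \<comment> \<open>The eigenvector equation divided by \<open>l * u $ i\<close>: the term
    \<open>j = i\<close> becomes the constant \<open>A $ i $ k / l\<close>, so
    \<open>u / u i\<close> is a fixed point of the same affine map.\<close>
  have u_eq: "u $ k / u $ i = A $ i $ k / l + (\<Sum>j\<in>-{i}. u $ j / u $ i * A $ j $ k) / l" for k
  proof -
    have "l * u $ k = u $ i * A $ i $ k + (\<Sum>j\<in>-{i}. u $ j * A $ j $ k)"
      using split[of u k] by (simp add: u(2))
    hence "u $ k = (u $ i * A $ i $ k + (\<Sum>j\<in>-{i}. u $ j * A $ j $ k)) / l"
      using l by (simp add: field_simps)
    hence "u $ k / u $ i = (u $ i * A $ i $ k + (\<Sum>j\<in>-{i}. u $ j * A $ j $ k)) / l / u $ i" by simp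
    also have "\<dots> = A $ i $ k / l + (\<Sum>j\<in>-{i}. u $ j * A $ j $ k) / u $ i / l"
      using u(1)[of i] l by (simp add: field_simps)
    finally show ?thesis by (simp add: sum_divide_distrib)
  qed
  \<comment> \<open>The affine map is monotone and \<open>W 0 = 0\<close> lies below its fixed point
    \<open>u / u i\<close>.\<close>
  have W_le: "W N k \<le> u $ k / u $ i" for N k
  proof (induction N arbitrary: k)
    case 0
    then show ?case using u(1)[of i] u(1)[of k] by (simp add: W_def)
  next
    case (Suc N)
    show ?case unfolding W_Suc u_eq[of k]
      using l by (intro add_left_mono divide_right_mono sum_mono mult_right_mono Suc nonneg) auto
  qed
  have summ: "summable (\<lambda>n. stopped_mean A i n k / l ^ Suc n)" for k
    by (rule summableI_nonneg_bounded[where x = "u $ k / u $ i"]) (use W_le tn l in \<open>auto simp: W_def\<close>)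
  define w where "w k = (\<Sum>n. stopped_mean A i n k / l ^ Suc n)" for k
  have W_lim: "(\<lambda>N. W N k) \<longlonglongrightarrow> w k" for k
    using summable_LIMSEQ[OF summ[of k]] by (simp add: W_def w_def)
  have w_eq: "w k = A $ i $ k / l + (\<Sum>j\<in>-{i}. w j * A $ j $ k) / l" for k
  proof (rule LIMSEQ_unique)
    show "(\<lambda>N. W (Suc N) k) \<longlonglongrightarrow> w k" by (rule LIMSEQ_Suc[OF W_lim])
    show "(\<lambda>N. W (Suc N) k) \<longlonglongrightarrow> A $ i $ k / l + (\<Sum>j\<in>-{i}. w j * A $ j $ k) / l"
      unfolding W_Suc using l by (intro tendsto_intros W_lim) auto
  qed
  define d where "d = (\<chi> k. u $ k / u $ i - w k)"
  have d_nonneg: "0 \<le> d $ k" for k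
    using LIMSEQ_le_const2[OF W_lim, of k "u $ k / u $ i"] W_le by (auto simp: d_def)
  \<comment> \<open>Both \<open>u / u i\<close> and \<open>w\<close> are fixed points of the affine
    map, so its constant cancels in the difference; the extra summand is the term
    \<open>j = i\<close> of \<open>d v* A\<close>.\<close>
  have dA: "(d v* A) $ k = l * d $ k + d $ i * A $ i $ k" for k
  proof -
    have "l * d $ k = l * (u $ k / u $ i) - l * w k" by (simp add: d_def algebra_simps)
    also have "\<dots> = (\<Sum>j\<in>-{i}. u $ j / u $ i * A $ j $ k) - (\<Sum>j\<in>-{i}. w j * A $ j $ k)"
      using l unfolding u_eq[of k] w_eq[of k] by (simp add: algebra_simps)
    also have "\<dots> = (\<Sum>j\<in>-{i}. d $ j * A $ j $ k)"
      by (simp add: d_def sum_subtractf algebra_simps)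
    finally show ?thesis by (simp add: split)
  qed
  have "l * d $ k \<le> (d v* A) $ k" for k
    unfolding dA using d_nonneg[of i] nonneg[of i k] by simp
  from subinvariant_proportional[OF A l u this] obtain c where c: "d = c *s u" by blast
  have "(d v* A) $ k = l * d $ k" for k
    unfolding c by (simp add: scalar_vector_matrix_assoc u(2))
  hence "d $ i * A $ i $ k = 0" for k using dA[of k] by simp
  \<comment> \<open>A zero row would persist in every power of exponent at least 1, against
    primitivity.\<close>
  moreover have "\<exists>k. A $ i $ k \<noteq> 0"
  proof (rule ccontr)
    assume "\<nexists>k. A $ i $ k \<noteq> 0"
    hence "matrix_power A m $ i $ i = 0" if "m \<ge> 1" for m
      using matrix_power_zero_row[of A i m i] that by blast
    thus False using A by (metis primitive_def less_irrefl)
  qed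
  ultimately have "d $ i = 0" by auto
  hence "c = 0" using c u(1)[of i] by simp
  hence "w k = u $ k / u $ i" using c by (simp add: d_def vec_eq_iff)
  thus ?thesis using summable_sums[OF summ[of k]] by (simp add: w_def)
qed

section \<open>Expectations along a Markov chain\<close>

lemma nn_integral_countable_image:
  fixes X :: "'a \<Rightarrow> 's :: countable" and f :: "'s \<Rightarrow> ennreal"
  assumes "X \<in> measurable M (count_space UNIV)"
  shows "(\<integral>\<^sup>+ w. f (X w) \<partial>M) = (\<integral>\<^sup>+ x. f x * emeasure M {w \<in> space M. X w = x} \<partial>count_space UNIV)"
proof -
  have "(\<integral>\<^sup>+ w. f (X w) \<partial>M) = (\<integral>\<^sup>+ w. (\<integral>\<^sup>+ x. f x * indicator {w \<in> space M. X w = x} w \<partial>count_space UNIV) \<partial>M)"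
  proof (rule nn_integral_cong)
    fix w assume w: "w \<in> space M"
    have "(\<integral>\<^sup>+ x. f x * indicator {w \<in> space M. X w = x} w \<partial>count_space UNIV)
      = (\<integral>\<^sup>+ x. f x * indicator {X w} x \<partial>count_space UNIV)"
      using w by (intro nn_integral_cong) (auto simp: indicator_def)
    thus "f (X w) = (\<integral>\<^sup>+ x. f x * indicator {w \<in> space M. X w = x} w \<partial>count_space UNIV)"
      by simp
  qed
  also have "\<dots> = (\<integral>\<^sup>+ x. (\<integral>\<^sup>+ w. f x * indicator {w \<in> space M. X w = x} w \<partial>M) \<partial>count_space UNIV)"
    using assms by (intro nn_integral_count_space_nn_integral) auto
  also have "\<dots> = (\<integral>\<^sup>+ x. f x * emeasure M {w \<in> space M. X w = x} \<partial>count_space UNIV)"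
    using assms by (intro nn_integral_cong nn_integral_cmult_indicator) auto
  finally show ?thesis .
qed

text \<open>Summed over the histories, the product formula gives the law of \<open>Z (Suc n)\<close>
  as a mixture of the kernels \<open>K n (Z n w)\<close>; Tonelli then allows \<open>f\<close> to be
  integrated against it.\<close>

lemma markov_chain_step:
  fixes Z :: "nat \<Rightarrow> 'w \<Rightarrow> 's :: countable" and f :: "'s \<Rightarrow> ennreal"
  assumes "markov_chain M K s Z"
  shows "(\<integral>\<^sup>+ w. f (Z (Suc n) w) \<partial>M) = (\<integral>\<^sup>+ w. (\<integral>\<^sup>+ y. f y \<partial>measure_pmf (K n (Z n w))) \<partial>M)"
proof -
  interpret prob_space M using assms by (simp add: markov_chain_def)
  have [measurable]: "\<And>n. Z n \<in> measurable M (count_space UNIV)"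
    and prod: "\<And>n z. \<P>(w in M. \<forall>m\<le>Suc n. Z m w = z m) =
            \<P>(w in M. \<forall>m\<le>n. Z m w = z m) * pmf (K n (z n)) (z (Suc n))"
    using assms by (auto simp: markov_chain_def)
  \<comment> \<open>Histories are encoded as lists because lists over a countable type are again
    countable. The last entry of \<open>H w\<close> is \<open>Z n w\<close>.\<close>
  define H where "H w = map (\<lambda>m. Z m w) [0..<Suc n]" for w
  have H_eq: "H w = xs \<longleftrightarrow> length xs = Suc n \<and> (\<forall>m\<le>n. Z m w = xs ! m)" for w xs
    by (auto simp: H_def list_eq_iff_nth_eq nth_append less_Suc_eq_le simp del: upt_Suc)
  have [measurable]: "H \<in> measurable M (count_space UNIV)"
  proof (subst measurable_count_space_eq2_countable, intro conjI ballI)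
    fix xs :: "'s list"
    have "H -` {xs} \<inter> space M = {w \<in> space M. length xs = Suc n \<and> (\<forall>m\<le>n. Z m w = xs ! m)}"
      using H_eq by auto
    also have "\<dots> \<in> sets M" by measurable
    finally show "H -` {xs} \<inter> space M \<in> sets M" .
  qed auto
  \<comment> \<open>The Markov property determines only whole trajectories, so one sums over the finite histories,
    which form a countable set.\<close>
  have joint: "emeasure M {w \<in> space M. H w = xs \<and> Z (Suc n) w = y}
     = emeasure M {w \<in> space M. H w = xs} * ennreal (pmf (K n (last xs)) y)" for xs y
  proof (cases "length xs = Suc n")
    case True
    \<comment> \<open>The history \<open>xs\<close> followed by \<open>y\<close>; only the values up
      to \<open>Suc n\<close> enter the product formula.\<close>
    define z where "z m = (if m \<le> n then xs ! m else y)" for m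
    have "last xs = z n" using True by (cases "xs = []") (auto simp: z_def last_conv_nth)
    moreover have "{w \<in> space M. H w = xs} = {w \<in> space M. \<forall>m\<le>n. Z m w = z m}"
      using True by (auto simp: H_eq z_def)
    moreover have "{w \<in> space M. H w = xs \<and> Z (Suc n) w = y} = {w \<in> space M. \<forall>m\<le>Suc n. Z m w = z m}"
      using True by (auto simp: H_eq z_def le_Suc_eq)
    moreover have "z (Suc n) = y" by (simp add: z_def)
    ultimately show ?thesis
      using prod[of n z] by (simp add: emeasure_eq_measure ennreal_mult)
  next
    case False
    hence "H w \<noteq> xs" for w by (auto simp: H_eq)
    thus ?thesis by simp
  qed
  have law: "emeasure M {w \<in> space M. Z (Suc n) w = y} = (\<integral>\<^sup>+ w. ennreal (pmf (K n (Z n w)) y) \<partial>M)" for y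
  proof -
    have "emeasure M {w \<in> space M. Z (Suc n) w = y} = (\<integral>\<^sup>+ w. indicator {w \<in> space M. Z (Suc n) w = y} w \<partial>M)"
      by simp
    also have "\<dots> = (\<integral>\<^sup>+ w. (\<integral>\<^sup>+ xs. indicator {w \<in> space M. H w = xs \<and> Z (Suc n) w = y} w \<partial>count_space UNIV) \<partial>M)"
    proof (rule nn_integral_cong)
      fix w assume w: "w \<in> space M"
      have "(\<integral>\<^sup>+ xs. indicator {w \<in> space M. H w = xs \<and> Z (Suc n) w = y} w \<partial>count_space UNIV)
        = (\<integral>\<^sup>+ xs. indicator {w \<in> space M. Z (Suc n) w = y} w * indicator {H w} xs \<partial>count_space UNIV)"
        using w by (intro nn_integral_cong) (auto simp: indicator_def)
      thus "indicator {w \<in> space M. Z (Suc n) w = y} w = (\<integral>\<^sup>+ xs. indicator {w \<in> space M. H w = xs \<and> Z (Suc n) w = y} w \<partial>count_space UNIV)"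
        by simp
    qed
    also have "\<dots> = (\<integral>\<^sup>+ xs. (\<integral>\<^sup>+ w. indicator {w \<in> space M. H w = xs \<and> Z (Suc n) w = y} w \<partial>M) \<partial>count_space UNIV)"
      by (intro nn_integral_count_space_nn_integral) auto
    also have "\<dots> = (\<integral>\<^sup>+ xs. ennreal (pmf (K n (last xs)) y) * emeasure M {w \<in> space M. H w = xs} \<partial>count_space UNIV)"
      by (intro nn_integral_cong) (simp add: joint mult.commute)
    also have "\<dots> = (\<integral>\<^sup>+ w. ennreal (pmf (K n (last (H w))) y) \<partial>M)"
      by (subst nn_integral_countable_image[where X = H]) auto
    finally show ?thesis by (simp add: H_def)
  qed
  have "(\<integral>\<^sup>+ w. f (Z (Suc n) w) \<partial>M)
      = (\<integral>\<^sup>+ y. f y * (\<integral>\<^sup>+ w. ennreal (pmf (K n (Z n w)) y) \<partial>M) \<partial>count_space UNIV)"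
    by (subst nn_integral_countable_image) (auto simp: law)
  also have "\<dots> = (\<integral>\<^sup>+ y. (\<integral>\<^sup>+ w. f y * ennreal (pmf (K n (Z n w)) y) \<partial>M) \<partial>count_space UNIV)"
    by (intro nn_integral_cong nn_integral_cmult[symmetric]) measurable
  also have "\<dots> = (\<integral>\<^sup>+ w. (\<integral>\<^sup>+ y. f y * ennreal (pmf (K n (Z n w)) y) \<partial>count_space UNIV) \<partial>M)"
    by (intro nn_integral_count_space_nn_integral[symmetric]) auto
  also have "\<dots> = (\<integral>\<^sup>+ w. (\<integral>\<^sup>+ y. f y \<partial>measure_pmf (K n (Z n w))) \<partial>M)"
    by (simp add: nn_integral_measure_pmf mult.commute)
  finally show ?thesis .
qed

section \<open>Means of the branching processes\<close>

text \<open>Linearity of expectation over the individuals, each of which has marginal law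
  \<open>p (fst x)\<close>; grouping them by type gives the factor \<open>z $ j\<close>.\<close>

lemma nn_integral_offspring_law:
  "(\<integral>\<^sup>+ y. of_nat (y $ k) \<partial>measure_pmf (offspring_law p z))
    = (\<Sum>j\<in>UNIV. of_nat (z $ j) * (\<integral>\<^sup>+ y. of_nat (y $ k) \<partial>measure_pmf (p j)))"
proof -
  have ind: "individuals z = (SIGMA j:UNIV. {..<z $ j})" by (auto simp: individuals_def)
  have fin: "finite (individuals z)" unfolding ind by auto
  have "(\<integral>\<^sup>+ y. of_nat (y $ k) \<partial>measure_pmf (offspring_law p z))
     = (\<integral>\<^sup>+ X. (\<Sum>x\<in>individuals z. of_nat (X x $ k)) \<partial>measure_pmf (Pi_pmf (individuals z) 0 (\<lambda>x. p (fst x))))"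
    by (simp add: offspring_law_def sum_component)
  also have "\<dots> = (\<Sum>x\<in>individuals z. \<integral>\<^sup>+ X. of_nat (X x $ k) \<partial>measure_pmf (Pi_pmf (individuals z) 0 (\<lambda>x. p (fst x))))"
    by (rule nn_integral_sum) simp
  also have "\<dots> = (\<Sum>x\<in>individuals z. \<integral>\<^sup>+ y. of_nat (y $ k) \<partial>measure_pmf (p (fst x)))"
  proof (rule sum.cong[OF refl])
    fix x assume x: "x \<in> individuals z"
    have "(\<integral>\<^sup>+ X. of_nat (X x $ k) \<partial>measure_pmf (Pi_pmf (individuals z) 0 (\<lambda>x. p (fst x))))
       = (\<integral>\<^sup>+ y. of_nat (y $ k) \<partial>measure_pmf (map_pmf (\<lambda>X. X x) (Pi_pmf (individuals z) 0 (\<lambda>x. p (fst x)))))"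
      by simp
    thus "(\<integral>\<^sup>+ X. of_nat (X x $ k) \<partial>measure_pmf (Pi_pmf (individuals z) 0 (\<lambda>x. p (fst x))))
       = (\<integral>\<^sup>+ y. of_nat (y $ k) \<partial>measure_pmf (p (fst x)))"
      \<comment> \<open>The default value 0 of \<open>Pi_pmf\<close> is taken only outside
        \<open>individuals z\<close>.\<close>
      using x fin by (simp only: Pi_pmf_component if_True)
  qed
  also have "\<dots> = (\<Sum>j\<in>UNIV. \<Sum>m<z $ j. \<integral>\<^sup>+ y. of_nat (y $ k) \<partial>measure_pmf (p j))"
    unfolding ind by (subst sum.Sigma) (auto simp: case_prod_unfold)
  finally show ?thesis by simp
qed

text \<open>The one-population formula averaged over \<open>Z n\<close>. The reproduction law may
  depend on the time \<open>n\<close>, as the stopped process requires.\<close>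

lemma markov_chain_offspring_mean:
  fixes Z :: "nat \<Rightarrow> 'w \<Rightarrow> nat ^ 'n"
  assumes "markov_chain M (\<lambda>n. offspring_law (p n)) s Z"
  shows "(\<integral>\<^sup>+ w. of_nat (Z (Suc n) w $ k) \<partial>M)
    = (\<Sum>j\<in>UNIV. (\<integral>\<^sup>+ w. of_nat (Z n w $ j) \<partial>M) * (\<integral>\<^sup>+ y. of_nat (y $ k) \<partial>measure_pmf (p n j)))"
proof -
  have [measurable]: "\<And>n. Z n \<in> measurable M (count_space UNIV)"
    using assms by (auto simp: markov_chain_def)
  have "(\<integral>\<^sup>+ w. of_nat (Z (Suc n) w $ k) \<partial>M)
    = (\<integral>\<^sup>+ w. (\<Sum>j\<in>UNIV. of_nat (Z n w $ j) * (\<integral>\<^sup>+ y. of_nat (y $ k) \<partial>measure_pmf (p n j))) \<partial>M)"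
    by (simp add: markov_chain_step[OF assms, where f = "\<lambda>z. of_nat (z $ k)"] nn_integral_offspring_law)
  also have "\<dots> = (\<Sum>j\<in>UNIV. \<integral>\<^sup>+ w. of_nat (Z n w $ j) * (\<integral>\<^sup>+ y. of_nat (y $ k) \<partial>measure_pmf (p n j)) \<partial>M)"
    by (rule nn_integral_sum) measurable
  also have "\<dots> = (\<Sum>j\<in>UNIV. (\<integral>\<^sup>+ w. of_nat (Z n w $ j) \<partial>M) * (\<integral>\<^sup>+ y. of_nat (y $ k) \<partial>measure_pmf (p n j)))"
    by (intro sum.cong refl nn_integral_multc) measurable
  finally show ?thesis .
qed

text \<open>The single ancestor leaves one term of the recursion. For \<open>Z\<close> this turns
  the assumption on the mean matrix into one on the reproduction laws; for the stopped process it
  gives generation 1.\<close>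

lemma markov_chain_first_mean:
  fixes Z :: "nat \<Rightarrow> 'w \<Rightarrow> nat ^ 'n"
  assumes mc: "markov_chain M (\<lambda>n. offspring_law (p n)) (axis i 1) Z"
  shows "(\<integral>\<^sup>+ w. of_nat (Z 1 w $ k) \<partial>M) = (\<integral>\<^sup>+ y. of_nat (y $ k) \<partial>measure_pmf (p 0 i))"
proof -
  interpret prob_space M using mc by (simp add: markov_chain_def)
  have "AE w in M. Z 0 w = axis i 1" using mc by (simp add: markov_chain_def)
  hence "(\<integral>\<^sup>+ w. of_nat (Z 0 w $ j) \<partial>M) = (\<integral>\<^sup>+ w. of_nat ((axis i 1 :: nat ^ 'n) $ j) \<partial>M)" for j
    by (intro nn_integral_cong_AE) auto
  hence init: "(\<integral>\<^sup>+ w. of_nat (Z 0 w $ j) \<partial>M) = (if j = i then 1 else 0)" for j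
    by (simp add: axis_def emeasure_space_1)
  show ?thesis
    using markov_chain_offspring_mean[OF mc, of 0 k]
    by (simp add: init if_distrib[of "\<lambda>x. x * _"] cong: if_cong)
qed

text \<open>At time 0 the stopped law is still \<open>p\<close>, so the ancestor contributes row
  \<open>i\<close> of \<open>A\<close>. From time 1 on, type \<open>i\<close> has offspring mean 0,
  which removes the index \<open>i\<close> from the sum.\<close>

lemma stopped_galton_watson_mean:
  assumes S: "stopped_galton_watson p i M S"
    and A: "\<And>j k. 0 \<le> A $ j $ k"
    and mean: "\<And>j k. (\<integral>\<^sup>+ y. of_nat (y $ k) \<partial>measure_pmf (p j)) = ennreal (A $ j $ k)"
  shows "(\<integral>\<^sup>+ w. of_nat (S (Suc n) w $ k) \<partial>M) = ennreal (stopped_mean A i n k)"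
proof (induction n arbitrary: k)
  case 0
  show ?case
    using markov_chain_first_mean[OF S[unfolded stopped_galton_watson_def], of k]
    by (simp add: stopped_law_def mean)
next
  case (Suc n)
  have "(\<integral>\<^sup>+ w. of_nat (S (Suc (Suc n)) w $ k) \<partial>M)
     = (\<Sum>j\<in>UNIV. ennreal (stopped_mean A i n j) * (if j = i then 0 else ennreal (A $ j $ k)))"
    unfolding markov_chain_offspring_mean[OF S[unfolded stopped_galton_watson_def], of "Suc n"] Suc
    by (intro sum.cong) (auto simp: stopped_law_def mean)
  also have "\<dots> = (\<Sum>j\<in>-{i}. ennreal (stopped_mean A i n j) * ennreal (A $ j $ k))"
    by (rule sum.mono_neutral_cong_right) auto
  finally show ?case
    by (simp add: ennreal_mult[symmetric] stopped_mean_nonneg A sum_ennreal mult_nonneg_nonneg)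
qed

section \<open>The formula for the normalized eigenvector\<close>

theorem theorem1:
  fixes A :: "real ^ 'n ^ 'n"
    and l :: real
    and u :: "real ^ 'n"
    and p :: "'n \<Rightarrow> (nat ^ 'n) pmf"
    and P :: "'n \<Rightarrow> 'a measure"
    and Z :: "nat \<Rightarrow> 'a \<Rightarrow> nat ^ 'n"
    and Q :: "'n \<Rightarrow> 'b measure"
    and S :: "'n \<Rightarrow> nat \<Rightarrow> 'b \<Rightarrow> nat ^ 'n"
  assumes "primitive A"
    and "pf_eigenvalue A l"
    and "\<And>i. galton_watson p i (P i) Z"
    and "\<And>i j. (\<integral>\<^sup>+ w. of_nat (Z 1 w $ j) \<partial>P i) = ennreal (A $ i $ j)"
    and "\<And>i. stopped_galton_watson p i (Q i) (S i)"
    and "normalized_pf_eigenvector A u"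
  shows "\<forall>i. ennreal (u $ i) =
    1 / (\<Sum>n. ennreal (1 / l ^ Suc n) * (\<integral>\<^sup>+ w. of_nat (population_size (S i (Suc n) w)) \<partial>Q i))"
proof
  fix i
  have nonneg: "0 \<le> A $ j $ k" for j k using assms(1) by (simp add: primitive_def)
  have u: "0 < u $ k" for k
    using assms(6) by (simp add: normalized_pf_eigenvector_def pf_eigenvector_def)
  obtain l' where l': "u v* A = l' *s u"
    using assms(6) by (auto simp: normalized_pf_eigenvector_def pf_eigenvector_def)
  obtain v where l: "0 < l" and v: "\<And>k. 0 < v $ k" "v v* A = l *s v"
    using assms(2) by (auto simp: pf_eigenvalue_def)
  \<comment> \<open>The definition of a Perron-Frobenius eigenvector provides only some eigenvalue
    \<open>l'\<close> for \<open>u\<close>; comparison with \<open>v\<close> in both directions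
    identifies it with \<open>l\<close>.\<close>
  have "l' = l"
    using positive_eigenvalue_le[OF nonneg u l' v] positive_eigenvalue_le[OF nonneg v u l'] by simp
  with l' have eig: "u v* A = l *s u" by simp
  have norm: "(\<Sum>k\<in>UNIV. u $ k) = 1"
    using assms(6) u by (simp add: normalized_pf_eigenvector_def abs_of_pos)
  have mean: "(\<integral>\<^sup>+ y. of_nat (y $ k) \<partial>measure_pmf (p j)) = ennreal (A $ j $ k)" for j k
    using markov_chain_first_mean[OF assms(3)[unfolded galton_watson_def], of j k] assms(4)[of j k]
    by simp
  have summand: "ennreal (1 / l ^ Suc n) * (\<integral>\<^sup>+ w. of_nat (population_size (S i (Suc n) w)) \<partial>Q i)
      = ennreal (\<Sum>k\<in>UNIV. stopped_mean A i n k / l ^ Suc n)" for n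
  proof -
    have [measurable]: "\<And>n. S i n \<in> measurable (Q i) (count_space UNIV)"
      using assms(5)[of i] by (auto simp: stopped_galton_watson_def markov_chain_def)
    have "(\<integral>\<^sup>+ w. of_nat (population_size (S i (Suc n) w)) \<partial>Q i)
      = (\<Sum>k\<in>UNIV. \<integral>\<^sup>+ w. of_nat (S i (Suc n) w $ k) \<partial>Q i)"
      unfolding population_size_def of_nat_sum by (rule nn_integral_sum) measurable
    also have "\<dots> = ennreal (\<Sum>k\<in>UNIV. stopped_mean A i n k)"
      by (simp add: stopped_galton_watson_mean[OF assms(5) nonneg mean] stopped_mean_nonneg nonneg)
    finally show ?thesis
      using l by (simp add: ennreal_mult'[symmetric] sum_divide_distrib[symmetric])
  qed
  have "(\<lambda>n. \<Sum>k\<in>UNIV. stopped_mean A i n k / l ^ Suc n) sums (\<Sum>k\<in>UNIV. u $ k / u $ i)"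
    by (intro sums_sum stopped_mean_sums assms(1) l u eig)
  also have "(\<Sum>k\<in>UNIV. u $ k / u $ i) = 1 / u $ i"
    by (simp add: sum_divide_distrib[symmetric] norm)
  finally have "(\<Sum>n. ennreal (\<Sum>k\<in>UNIV. stopped_mean A i n k / l ^ Suc n)) = ennreal (1 / u $ i)"
    using l by (intro suminf_ennreal_eq) (auto intro!: sum_nonneg divide_nonneg_nonneg stopped_mean_nonneg nonneg)
  \<comment> \<open>Since \<open>u $ i\<close> is positive and finite, inverting
    \<open>1 / u $ i\<close> in \<open>[0, \<infinity>]\<close> agrees with the real
    inverse.\<close>
  thus "ennreal (u $ i) =
    1 / (\<Sum>n. ennreal (1 / l ^ Suc n) * (\<integral>\<^sup>+ w. of_nat (population_size (S i (Suc n) w)) \<partial>Q i))"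
    unfolding summand using u[of i] by (simp add: divide_ennreal ennreal_1[symmetric] del: ennreal_1)
qed

end
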